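(* Let $m$ and $n$ be positive integers, where $m$ is even, and let $A$ and $B$ be $m\times n$ matrices. Then $$\sum_{1\le i_1<j_1\le i_2<j_2\le\cdots\le i_{m/2}<j_{m/2}\le n}\det(A^{i_1}B^{j_1}A^{i_2}B^{j_2}\cdots A^{i_{m/2}}B^{j_{m/2}})=\operatorname{Pf}\bigl(AU_nB^t-BU_n^tA^t\bigr)$$ and $$\sum_{1\le i_1\le j_1<i_2\le j_2<\cdots<i_{m/2}\le j_{m/2}\le n}\det(A^{i_1}B^{j_1}A^{i_2}B^{j_2}\cdots A^{i_{m/2}}B^{j_{m/2}})=\operatorname{Pf}\bigl(A(U_n+\operatorname{Id}_n)B^t-B(U_n^t+\operatorname{Id}_n)A^t\bigr).$$
   Context: All matrices have entries in a commutative ring with unit. $U_n$ is the $n\times n$ upper triangular matrix with all entries strictly above the diagonal equal to $1$ and all other entries equal to $0$; $\operatorname{Id}_n$ is the $n\times n$ identity matrix. $A^i$ and $B^i$ denote the $i$-th columns of $A$ and $B$, and $A^{i_1}B^{j_1}\cdots A^{i_{m/2}}B^{j_{m/2}}$ is the $m\times m$ matrix obtained by placing these columns side by side in this order. For a skew-symmetric matrix $Y$ of even size $m$ (with zero diagonal), the Pfaffian is $\operatorname{Pf}(Y)=\sum_{\mu}\operatorname{sgn}\mu\prod_{\{i,j\}\in\mu,\ i<j}Y_{i,j}$, the sum being over all perfect matchings $\mu$ of $\{1,\dots,m\}$, where $\operatorname{sgn}\mu=(-1)^{\mathrm{cr}(\mu)}$ and $\mathrm{cr}(\mu)$ is the number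 of quadruples $i<j<k<l$ such that $\{i,k\}$ and $\{j,l\}$ are pairs in $\mu$. *)

theory Defs
  imports
    "Jordan_Normal_Form.Determinant"
    "HOL-Library.Disjoint_Sets"
begin

text \<open>Rows, columns and matched points are numbered from \<open>0\<close>, so an index \<open>i\<close> with
  \<open>1 \<le> i \<le> n\<close> of the usual notation is \<open>i - 1 < n\<close> here.\<close>

definition strict_upper_ones :: "nat \<Rightarrow> 'a :: zero_neq_one mat" where
  "strict_upper_ones n = mat n n (\<lambda>(i, j). if i < j then 1 else 0)"

definition perfect_matchings :: "nat \<Rightarrow> nat set set set" where
  "perfect_matchings m = {\<mu>. partition_on {0..<m} \<mu> \<and> (\<forall>e\<in>\<mu>. card e = 2)}"

definition crossings :: "nat set set \<Rightarrow> nat" where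
  "crossings \<mu> =
     card {(i, j, k, l). i < j \<and> j < k \<and> k < l \<and> {i, k} \<in> \<mu> \<and> {j, l} \<in> \<mu>}"

text \<open>The value is the Pfaffian when \<open>Y\<close> is square, skew-symmetric and has zero diagonal;
  only the entries above the diagonal enter the formula.\<close>

definition pfaffian :: "'a :: comm_ring_1 mat \<Rightarrow> 'a" where
  "pfaffian Y =
     (\<Sum>\<mu>\<in>perfect_matchings (dim_row Y).
        (-1) ^ crossings \<mu> * (\<Prod>(i, j)\<in>{(i, j). i < j \<and> {i, j} \<in> \<mu>}. Y $$ (i, j)))"

text \<open>The pairs of lists \<open>[i\<^sub>1, \<dots>, i\<^sub>h]\<close>, \<open>[j\<^sub>1, \<dots>, j\<^sub>h]\<close> of indices below \<open>n\<close> with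
  \<open>i\<^sub>1 < j\<^sub>1 \<le> i\<^sub>2 < j\<^sub>2 \<le> \<dots> \<le> i\<^sub>h < j\<^sub>h\<close>.\<close>

definition strict_weak_indices :: "nat \<Rightarrow> nat \<Rightarrow> (nat list \<times> nat list) set" where
  "strict_weak_indices h n =
     {(is, js). length is = h \<and> length js = h \<and> set is \<subseteq> {0..<n} \<and> set js \<subseteq> {0..<n} \<and>
        (\<forall>k<h. is ! k < js ! k) \<and> (\<forall>k. Suc k < h \<longrightarrow> js ! k \<le> is ! Suc k)}"

text \<open>Likewise with \<open>i\<^sub>1 \<le> j\<^sub>1 < i\<^sub>2 \<le> j\<^sub>2 < \<dots> < i\<^sub>h \<le> j\<^sub>h\<close>.\<close>

definition weak_strict_indices :: "nat \<Rightarrow> nat \<Rightarrow> (nat list \<times> nat list) set" where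
  "weak_strict_indices h n =
     {(is, js). length is = h \<and> length js = h \<and> set is \<subseteq> {0..<n} \<and> set js \<subseteq> {0..<n} \<and>
        (\<forall>k<h. is ! k \<le> js ! k) \<and> (\<forall>k. Suc k < h \<longrightarrow> js ! k < is ! Suc k)}"

text \<open>The matrix with columns \<open>A\<close> at \<open>i\<^sub>1\<close>, \<open>B\<close> at \<open>j\<^sub>1\<close>, \<open>A\<close> at \<open>i\<^sub>2\<close>, \<open>B\<close> at \<open>j\<^sub>2\<close>, and so on.\<close>

definition interleaved_cols :: "'a mat \<Rightarrow> 'a mat \<Rightarrow> nat list \<Rightarrow> nat list \<Rightarrow> 'a mat" where
  "interleaved_cols A B is js =
     mat_of_cols (dim_row A) (concat (map2 (\<lambda>i j. [col A i, col B j]) is js))"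

lemma finite_index_lists:
  "finite ({is. set is \<subseteq> {0..<n} \<and> length is = h} \<times> {js. set js \<subseteq> {0..<n :: nat} \<and> length js = h})"
  by (intro finite_cartesian_product finite_lists_length_eq finite_atLeastLessThan)

lemma finite_strict_weak_indices: "finite (strict_weak_indices h n)"
  by (rule finite_subset[OF _ finite_index_lists[of n h]]) (auto simp: strict_weak_indices_def)

lemma finite_weak_strict_indices: "finite (weak_strict_indices h n)"
  by (rule finite_subset[OF _ finite_index_lists[of n h]]) (auto simp: weak_strict_indices_def)

lemma finite_perfect_matchings: "finite (perfect_matchings m)"
  by (rule finite_subset[of _ "Pow (Pow {0..<m})"])
    (auto simp: perfect_matchings_def partition_on_def)

lemma finite_perfect_matching_pairs:
  assumes "\<mu> \<in> perfect_matchings m"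
  shows "finite {(i, j). i < j \<and> {i, j} \<in> \<mu>}"
  by (rule finite_subset[of _ "{0..<m} \<times> {0..<m}"])
    (use assms in \<open>auto simp: perfect_matchings_def partition_on_def\<close>)

lemma finite_perfect_matching_crossings:
  assumes "\<mu> \<in> perfect_matchings m"
  shows "finite {(i, j, k, l). i < j \<and> j < k \<and> k < l \<and> {i, k} \<in> \<mu> \<and> {j, l} \<in> \<mu>}"
  by (rule finite_subset[of _ "{0..<m} \<times> {0..<m} \<times> {0..<m} \<times> {0..<m}"])
    (use assms in \<open>auto simp: perfect_matchings_def partition_on_def\<close>)

lemma interleaved_cols_carrier:
  assumes "A \<in> carrier_mat m n" "even m" "length is = m div 2" "length js = m div 2"
  shows "interleaved_cols A B is js \<in> carrier_mat m m"
proof -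
  have "length (concat (map2 (\<lambda>i j. [col A i, col B j]) is js)) = 2 * (m div 2)"
    using assms(3,4) by (simp add: length_concat comp_def case_prod_unfold sum_list_triv)
  then show ?thesis
    using assms(1,2) mat_of_cols_carrier(1)[of m "concat (map2 (\<lambda>i j. [col A i, col B j]) is js)"]
    by (simp add: interleaved_cols_def)
qed

end

theory Submission
  imports Defs
begin

text \<open>
  The idea is to compute in an exterior algebra with generators \<open>e\<^sub>p\<close>. Put
  \<open>a\<^sub>i = \<Sum>\<^sub>p A\<^sub>p\<^sub>i e\<^sub>p\<close> and \<open>b\<^sub>j = \<Sum>\<^sub>p B\<^sub>p\<^sub>j e\<^sub>p\<close>. The Pfaffian of a matrix \<open>Y\<close> is the top
  coefficient of the exponential (formed with divided powers) of the 2-form \<open>\<Sum>\<^sub>p\<^sub><\<^sub>q Y\<^sub>p\<^sub>q e\<^sub>p e\<^sub>q\<close>, and a determinant is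
  the top coefficient of the product of its columns. The two matrices of the theorem give the
  2-forms \<open>\<Sum> a\<^sub>i b\<^sub>j\<close> over \<open>i < j\<close> and over \<open>i \<le> j\<close>. Both cases are treated at once by numbers
  \<open>c + d = 1\<close>: a pair has to satisfy \<open>i + c \<le> j\<close>, and the next pair starts at \<open>j + d\<close> or later.

  Let \<open>t\<^sub>k = \<Sum>\<^sub>j\<^sub>\<ge>\<^sub>k b\<^sub>j\<close>, and let \<open>P\<^sub>k\<close> be the exponential of the part \<open>\<Sum>\<^sub>i\<^sub>\<ge>\<^sub>k a\<^sub>i t\<^sub>i\<^sub>+\<^sub>c\<close> of the 2-form.
  The summand \<open>a\<^sub>k t\<^sub>k\<^sub>+\<^sub>c\<close> has square zero, so \<open>P\<^sub>k = P\<^sub>k\<^sub>+\<^sub>1 + a\<^sub>k t\<^sub>k\<^sub>+\<^sub>c P\<^sub>k\<^sub>+\<^sub>1\<close>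
  (\<open>pf_list_update\<close>, the rank two update of a Pfaffian). Since \<open>t\<^sub>k\<^sub>+\<^sub>c\<close> has square zero as well,
  it does not see the difference between \<open>P\<^sub>k\<close> and \<open>P\<^sub>k\<^sub>+\<^sub>1\<close>. Splitting off \<open>b\<^sub>k\<close> from \<open>t\<^sub>k\<close>
  repeatedly then gives \<open>t\<^sub>k P\<^sub>k = \<Sum>\<^sub>j\<^sub>\<ge>\<^sub>k b\<^sub>j P\<^sub>j\<^sub>+\<^sub>d\<close> (\<open>wedge_tail_sum_pf\<close>), hence
  \<open>P\<^sub>k = P\<^sub>k\<^sub>+\<^sub>1 + \<Sum>\<^sub>j\<^sub>\<ge>\<^sub>k\<^sub>+\<^sub>c a\<^sub>k b\<^sub>j P\<^sub>j\<^sub>+\<^sub>d\<close> (\<open>pf_pair_form_first_pair\<close>).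
  This is exactly the recursion that chooses the first pair of an index sequence, so \<open>P\<^sub>0\<close> is
  the sum of the products \<open>a\<^bsub>i\<^sub>1\<^esub> b\<^bsub>j\<^sub>1\<^esub> a\<^bsub>i\<^sub>2\<^esub> b\<^bsub>j\<^sub>2\<^esub> \<dots>\<close> over all admissible sequences
  (\<open>pf_pair_form_eq_sum_chains\<close>).

  What remains is to identify the two sides: the product of the columns is a determinant by
  Laplace expansion (\<open>det_eq_wedge\<close>), and the Pfaffian defined by matchings satisfies the
  expansion along the smallest index, where the crossings produce the sign
  (\<open>sum_matchings_eq_pf_list\<close>).
\<close>

section \<open>Exterior multiplication by a vector\<close>

text \<open>An element of the exterior algebra is represented by its coefficients: \<open>F [p, q, \<dots>]\<close> is the
  coefficient at \<open>e\<^sub>p e\<^sub>q \<dots>\<close>. The recursion says that the contraction by \<open>e\<^sub>x\<close> is a graded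
  derivation, \<open>\<partial>\<^sub>x (v F) = v\<^sub>x F - v (\<partial>\<^sub>x F)\<close>, where \<open>\<partial>\<^sub>x F\<close> is \<open>\<lambda>ys. F (x # ys)\<close>. Arbitrary
  functions \<open>F\<close> are allowed; the signs all come from this rule.\<close>

fun wedge :: "('b \<Rightarrow> 'a) \<Rightarrow> ('b list \<Rightarrow> 'a) \<Rightarrow> 'b list \<Rightarrow> 'a :: comm_ring_1" where
  "wedge v F [] = 0"
| "wedge v F (x # xs) = v x * F xs - wedge v (\<lambda>ys. F (x # ys)) xs"

text \<open>Only the coefficients at lists that are one shorter enter a product with a vector. This
  makes recursion through \<open>wedge\<close> terminate, and it lets identities that hold in one degree
  only be used inside a product.\<close>

lemma wedge_cong [fundef_cong]:
  assumes "xs = xs'" and "\<And>x. x \<in> set xs' \<Longrightarrow> v x = w x"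
    and "\<And>ys. Suc (length ys) = length xs' \<Longrightarrow> set ys \<subseteq> set xs' \<Longrightarrow> F ys = G ys"
  shows "wedge v F xs = wedge w G xs'"
  unfolding assms(1) using assms(2,3)
proof (induction xs' arbitrary: F G)
  case (Cons x xs)
  have "wedge v (\<lambda>ys. F (x # ys)) xs = wedge w (\<lambda>ys. G (x # ys)) xs"
    by (rule Cons.IH) (use Cons.prems in \<open>auto intro!: Cons.prems(2)\<close>)
  moreover have "F xs = G xs"
    by (rule Cons.prems(2)) auto
  ultimately show ?case using Cons.prems(1) by simp
qed simp

lemma wedge_add: "wedge v (\<lambda>ys. F ys + G ys) xs = wedge v F xs + wedge v G xs"
  by (induction xs arbitrary: F G) (auto simp: algebra_simps)

lemma wedge_diff: "wedge v (\<lambda>ys. F ys - G ys) xs = wedge v F xs - wedge v G xs"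
  by (induction xs arbitrary: F G) (auto simp: algebra_simps)

lemma wedge_scale: "wedge v (\<lambda>ys. c * F ys) xs = c * wedge v F xs"
  by (induction xs arbitrary: F) (auto simp: algebra_simps)

lemma wedge_zero: "wedge v (\<lambda>ys. 0) xs = 0"
  by (induction xs) auto

lemma wedge_sum: "wedge v (\<lambda>ys. \<Sum>j\<in>J. F j ys) xs = (\<Sum>j\<in>J. wedge v (F j) xs)"
  by (induction J rule: infinite_finite_induct) (simp_all add: wedge_zero wedge_add)

lemma wedge_add_left: "wedge (\<lambda>x. v x + w x) F xs = wedge v F xs + wedge w F xs"
  by (induction xs arbitrary: F) (auto simp: algebra_simps)

lemma wedge_scale_left: "wedge (\<lambda>x. c * v x) F xs = c * wedge v F xs"
  by (induction xs arbitrary: F) (auto simp: algebra_simps)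

lemma wedge_diff_left: "wedge (\<lambda>x. v x - w x) F xs = wedge v F xs - wedge w F xs"
  by (induction xs arbitrary: F) (auto simp: algebra_simps)

lemma wedge_zero_left: "wedge (\<lambda>x. 0) F xs = 0"
  by (induction xs arbitrary: F) auto

lemma wedge_square: "wedge v (wedge v F) xs = 0"
proof (induction xs arbitrary: F)
  case (Cons x xs)
  have "wedge v (\<lambda>ys. wedge v F (x # ys)) xs = v x * wedge v F xs"
    using Cons.IH by (simp add: wedge_diff wedge_scale)
  then show ?case by simp
qed simp

text \<open>Polarization of \<open>(v + w)\<^sup>2 = 0\<close>.\<close>

lemma wedge_anticommute: "wedge v (wedge w F) xs = - wedge w (wedge v F) xs"
proof -
  have "0 = wedge (\<lambda>x. v x + w x) (wedge (\<lambda>x. v x + w x) F) xs"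
    by (simp only: wedge_square)
  also have "\<dots> = wedge v (wedge w F) xs + wedge w (wedge v F) xs"
    unfolding ext[OF wedge_add_left[of v w F]]
    by (simp add: wedge_add_left wedge_add wedge_square)
  finally show ?thesis by (simp add: eq_neg_iff_add_eq_0)
qed

lemma wedge_sandwich: "wedge v (wedge w (wedge v F)) xs = 0"
proof -
  have "wedge v (wedge w (wedge v F)) xs = - wedge w (wedge v (wedge v F)) xs"
    by (rule wedge_anticommute)
  also have "wedge v (wedge v F) = (\<lambda>ys. 0)"
    by (simp add: wedge_square fun_eq_iff)
  finally show ?thesis by (simp add: wedge_zero)
qed

section \<open>Pfaffians as elements of the exterior algebra\<close>

text \<open>The expansion of a Pfaffian along its first row, read as the differential equation
  \<open>\<partial>\<^sub>x P = Y\<^sub>x P\<close> of an exponential.\<close>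

function pf_list :: "('b \<Rightarrow> 'b \<Rightarrow> 'a) \<Rightarrow> 'b list \<Rightarrow> 'a :: comm_ring_1" where
  "pf_list Y [] = 1"
| "pf_list Y (x # xs) = wedge (Y x) (\<lambda>ys. pf_list Y ys) xs"
  by pat_completeness auto
termination
  by (relation "measure (\<lambda>(Y, xs). length xs)") auto

lemma pf_list_cong:
  assumes "\<And>x y. x \<in> set xs \<Longrightarrow> y \<in> set xs \<Longrightarrow> Y x y = Z x y"
  shows "pf_list Y xs = pf_list Z xs"
  using assms
proof (induction "length xs" arbitrary: xs rule: less_induct)
  case less
  show ?case
  proof (cases xs)
    case (Cons x ys)
    then show ?thesis
      using less by (auto intro!: wedge_cong less.hyps)
  qed simp
qed

definition unit_form :: "'b list \<Rightarrow> 'a :: comm_ring_1" where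
  "unit_form xs = (if xs = [] then 1 else 0)"

lemma pf_list_zero: "(pf_list (\<lambda>x y. 0) :: 'b list \<Rightarrow> 'a :: comm_ring_1) = unit_form"
proof
  fix xs :: "'b list"
  show "pf_list (\<lambda>x y. 0) xs = (unit_form xs :: 'a)"
    by (cases xs) (simp_all add: unit_form_def wedge_zero_left)
qed

text \<open>With \<open>P = pf_list Y\<close>, the element \<open>P + s t P\<close> satisfies the equation that defines the
  Pfaffian of the updated matrix: applying \<open>\<partial>\<^sub>x\<close> to it gives
  \<open>Y\<^sub>x P + s\<^sub>x t P - t\<^sub>x s P + s t Y\<^sub>x P\<close>, and multiplying it by the updated row
  \<open>Y\<^sub>x + s\<^sub>x t - t\<^sub>x s\<close> gives the same because \<open>s\<close> and \<open>t\<close> have square zero and \<open>Y\<^sub>x\<close> commutes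
  with \<open>s t\<close>.\<close>

lemma pf_list_update:
  "pf_list (\<lambda>x y. Y x y + (s x * t y - t x * s y)) xs
     = pf_list Y xs + wedge s (wedge t (pf_list Y)) xs"
proof (induction "length xs" arbitrary: xs rule: less_induct)
  case less
  let ?Z = "\<lambda>x y. Y x y + (s x * t y - t x * s y)"
  let ?P = "pf_list Y"
  show ?case
  proof (cases xs)
    case (Cons x ys)
    have "pf_list ?Z xs = wedge (?Z x) (\<lambda>zs. ?P zs + wedge s (wedge t ?P) zs) ys"
      unfolding Cons pf_list.simps
      by (rule wedge_cong) (use less Cons in auto)
    also have "\<dots> = wedge (Y x) ?P ys + s x * wedge t ?P ys - t x * wedge s ?P ys
        + wedge (Y x) (wedge s (wedge t ?P)) ys"
      by (simp add: wedge_add wedge_add_left wedge_diff_left wedge_scale_left wedge_square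
          wedge_sandwich)
    also have "wedge (Y x) (wedge s (wedge t ?P)) ys = wedge s (wedge t (wedge (Y x) ?P)) ys"
    proof -
      have "wedge (Y x) (wedge s (wedge t ?P)) ys = - wedge s (wedge (Y x) (wedge t ?P)) ys"
        by (rule wedge_anticommute)
      also have "wedge (Y x) (wedge t ?P) = (\<lambda>zs. - 1 * wedge t (wedge (Y x) ?P) zs)"
        by (simp add: wedge_anticommute[of "Y x" t] fun_eq_iff)
      finally show ?thesis by (simp only: wedge_scale) simp
    qed
    finally show ?thesis
      by (simp add: Cons wedge_diff wedge_scale)
  qed simp
qed

section \<open>Determinants as products of columns\<close>

lemma wedge_eq_sum:
  "wedge v F xs = (\<Sum>k<length xs. (- 1) ^ k * v (xs ! k) * F (take k xs @ drop (Suc k) xs))"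
  by (induction xs arbitrary: F)
    (simp_all del: sum.lessThan_Suc add: sum.lessThan_Suc_shift sum_negf)

text \<open>Unfolding the leftmost product with \<open>wedge_eq_sum\<close> is the Laplace expansion along the first
  column; the rows that remain form the list of the minor.\<close>

lemma det_eq_wedge:
  assumes "length cs = length rs"
  shows "det (mat (length rs) (length rs) (\<lambda>(i, j). (cs ! j) (rs ! i))) = foldr wedge cs unit_form rs"
  using assms
proof (induction cs arbitrary: rs)
  case Nil
  then show ?case by (simp add: unit_form_def)
next
  case (Cons c cs)
  let ?n = "length rs"
  let ?M = "mat ?n ?n (\<lambda>(i, j). ((c # cs) ! j) (rs ! i))"
  have minor: "det (mat_delete ?M i 0) = foldr wedge cs unit_form (take i rs @ drop (Suc i) rs)"
    if "i < ?n" for i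
  proof -
    let ?rs = "take i rs @ drop (Suc i) rs"
    have "mat_delete ?M i 0 = mat (length ?rs) (length ?rs) (\<lambda>(i, j). (cs ! j) (?rs ! i))"
      by (rule eq_matI) (use that in \<open>auto simp: mat_delete_def nth_append min_def\<close>)
    then show ?thesis using Cons.IH[of ?rs] Cons.prems that by simp
  qed
  have "0 < ?n" using Cons.prems by auto
  have "det ?M = (\<Sum>i<?n. ?M $$ (i, 0) * cofactor ?M i 0)"
    by (rule laplace_expansion_column) (use \<open>0 < ?n\<close> in auto)
  also have "\<dots> = (\<Sum>i<?n. (- 1) ^ i * c (rs ! i) * foldr wedge cs unit_form (take i rs @ drop (Suc i) rs))"
    by (rule sum.cong) (use \<open>0 < ?n\<close> in \<open>auto simp: cofactor_def minor\<close>)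
  finally show ?case by (simp add: wedge_eq_sum[of c])
qed

section \<open>Admissible index sequences\<close>

text \<open>Both orders of the theorem in one predicate, with \<open>c = 1, d = 0\<close> and \<open>c = 0, d = 1\<close>
  respectively. The lower bound \<open>k\<close> for the first index is what changes when the first pair is
  removed.\<close>

fun chain :: "nat \<Rightarrow> nat \<Rightarrow> nat \<Rightarrow> nat \<Rightarrow> nat list \<Rightarrow> nat list \<Rightarrow> bool" where
  "chain c d n k [] [] \<longleftrightarrow> True"
| "chain c d n k (i # is) (j # js) \<longleftrightarrow> k \<le> i \<and> i + c \<le> j \<and> j < n \<and> chain c d n (j + d) is js"
| "chain c d n k _ _ \<longleftrightarrow> False"

definition index_chains :: "nat \<Rightarrow> nat \<Rightarrow> nat \<Rightarrow> nat \<Rightarrow> nat \<Rightarrow> (nat list \<times> nat list) set" where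
  "index_chains c d n h k = {(is, js). length is = h \<and> chain c d n k is js}"

lemma chain_iff:
  "chain c d n k is js \<longleftrightarrow>
     length js = length is \<and> set is \<subseteq> {0..<n} \<and> set js \<subseteq> {0..<n} \<and> (is \<noteq> [] \<longrightarrow> k \<le> is ! 0) \<and>
     (\<forall>l<length is. is ! l + c \<le> js ! l) \<and> (\<forall>l. Suc l < length is \<longrightarrow> js ! l + d \<le> is ! Suc l)"
proof (induction c d n k "is" js rule: chain.induct)
  case (2 c d n k i "is" j js)
  have "(\<forall>l. Suc l < length (i # is) \<longrightarrow> P l) \<longleftrightarrow>
      (is \<noteq> [] \<longrightarrow> P 0) \<and> (\<forall>l. Suc l < length is \<longrightarrow> P (Suc l))" for P
    by (cases "is") (auto simp: less_Suc_eq_0_disj)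
  then show ?case
    using 2 by (auto simp: All_less_Suc2)
qed auto

lemma strict_weak_indices_eq_index_chains: "strict_weak_indices h n = index_chains 1 0 n h 0"
  by (auto simp: strict_weak_indices_def index_chains_def chain_iff Suc_le_eq)

lemma weak_strict_indices_eq_index_chains: "weak_strict_indices h n = index_chains 0 1 n h 0"
  by (auto simp: weak_strict_indices_def index_chains_def chain_iff Suc_le_eq)

lemma finite_index_chains: "finite (index_chains c d n h k)"
  by (rule finite_subset[OF _ finite_index_lists[of n h]]) (auto simp: index_chains_def chain_iff)

lemma index_chains_0: "index_chains c d n 0 k = {([], [])}"
  by (auto simp: index_chains_def chain_iff)

lemma sum_index_chains_Suc:
  "(\<Sum>(is, js)\<in>index_chains c d n (Suc h) k. f is js)
     = (\<Sum>i\<in>{k..<n}. \<Sum>j\<in>{i + c..<n}. \<Sum>(is, js)\<in>index_chains c d n h (j + d). f (i # is) (j # js))"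
proof -
  let ?S = "SIGMA i:{k..<n}. SIGMA j:{i + c..<n}. index_chains c d n h (j + d)"
  have "(\<Sum>i\<in>{k..<n}. \<Sum>j\<in>{i + c..<n}. \<Sum>(is, js)\<in>index_chains c d n h (j + d). f (i # is) (j # js))
      = (\<Sum>(i, j, is, js)\<in>?S. f (i # is) (j # js))"
    by (subst sum.Sigma; simp add: finite_index_chains sum.Sigma)+
  also have "\<dots> = (\<Sum>(is, js)\<in>index_chains c d n (Suc h) k. f is js)"
    by (rule sum.reindex_bij_witness[where
          i = "\<lambda>(is, js). (hd is, hd js, tl is, tl js)" and j = "\<lambda>(i, j, is, js). (i # is, j # js)"])
      (auto simp: index_chains_def length_Suc_conv elim: chain.elims)
  finally show ?thesis by simp
qed


section \<open>Expanding the Pfaffian by the first pair\<close>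

definition interleave :: "(nat \<Rightarrow> 'v) \<Rightarrow> (nat \<Rightarrow> 'v) \<Rightarrow> nat list \<Rightarrow> nat list \<Rightarrow> 'v list" where
  "interleave a b is js = concat (map2 (\<lambda>i j. [a i, b j]) is js)"

lemma interleave_simps [simp]:
  "interleave a b [] [] = []"
  "interleave a b (i # is) (j # js) = a i # b j # interleave a b is js"
  by (simp_all add: interleave_def)

definition tail_sum :: "(nat \<Rightarrow> 'b \<Rightarrow> 'a :: comm_ring_1) \<Rightarrow> nat \<Rightarrow> nat \<Rightarrow> 'b \<Rightarrow> 'a" where
  "tail_sum b n k x = (\<Sum>j\<in>{k..<n}. b j x)"

text \<open>The skew-symmetric matrix of the 2-form \<open>\<Sum>\<^sub>i\<^sub>\<ge>\<^sub>k a\<^sub>i t\<^sub>i\<^sub>+\<^sub>c\<close>.\<close>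

definition pair_form ::
    "(nat \<Rightarrow> 'b \<Rightarrow> 'a :: comm_ring_1) \<Rightarrow> (nat \<Rightarrow> 'b \<Rightarrow> 'a) \<Rightarrow> nat \<Rightarrow> nat \<Rightarrow> nat \<Rightarrow> 'b \<Rightarrow> 'b \<Rightarrow> 'a" where
  "pair_form a b n c k x y =
     (\<Sum>i\<in>{k..<n}. a i x * tail_sum b n (i + c) y - tail_sum b n (i + c) x * a i y)"

lemma tail_sum_rec: "k < n \<Longrightarrow> tail_sum b n k = (\<lambda>x. b k x + tail_sum b n (Suc k) x)"
  by (simp add: tail_sum_def sum.atLeast_Suc_lessThan fun_eq_iff)

lemma pf_pair_form_rec:
  assumes "k < n"
  shows "pf_list (pair_form a b n c k) xs = pf_list (pair_form a b n c (Suc k)) xs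
    + wedge (a k) (wedge (tail_sum b n (k + c)) (pf_list (pair_form a b n c (Suc k)))) xs"
proof -
  have "pair_form a b n c k = (\<lambda>x y. pair_form a b n c (Suc k) x y
      + (a k x * tail_sum b n (k + c) y - tail_sum b n (k + c) x * a k y))"
    using assms by (simp add: pair_form_def sum.atLeast_Suc_lessThan fun_eq_iff)
  then show ?thesis by (simp only: pf_list_update)
qed

text \<open>The two Pfaffians differ by a multiple of \<open>a\<^sub>k t\<^sub>k\<^sub>+\<^sub>c\<close>, which \<open>t\<^sub>k\<^sub>+\<^sub>c\<close> annihilates.\<close>

lemma wedge_tail_sum_absorb:
  assumes "k < n"
  shows "wedge (tail_sum b n (k + c)) (pf_list (pair_form a b n c k)) xs
    = wedge (tail_sum b n (k + c)) (pf_list (pair_form a b n c (Suc k))) xs"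
  unfolding ext[OF pf_pair_form_rec[OF assms]]
  by (simp add: wedge_add wedge_sandwich)

text \<open>In \<open>t\<^sub>k P\<^sub>k\<close> the part \<open>t\<^sub>k\<^sub>+\<^sub>1\<close> of \<open>t\<^sub>k\<close> should meet \<open>P\<^sub>k\<^sub>+\<^sub>1\<close> for the induction to proceed.
  For \<open>c = 1\<close> the absorption applies to \<open>t\<^sub>k\<^sub>+\<^sub>1 P\<^sub>k\<close>, after \<open>b\<^sub>k P\<^sub>k\<close> has been split off. For
  \<open>c = 0\<close> it applies to \<open>t\<^sub>k P\<^sub>k\<close>, so that the term split off is \<open>b\<^sub>k P\<^sub>k\<^sub>+\<^sub>1\<close>. This is why the next
  pair may reuse the index \<open>j\<close> in the first case only.\<close>

lemma wedge_tail_sum_pf: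
  assumes "c + d = 1" "k \<le> n"
  shows "wedge (tail_sum b n k) (pf_list (pair_form a b n c k)) xs
    = (\<Sum>j\<in>{k..<n}. wedge (b j) (pf_list (pair_form a b n c (j + d))) xs)"
  using assms(2)
proof (induction k rule: inc_induct)
  case base
  then show ?case by (simp add: tail_sum_def wedge_zero_left)
next
  case (step k)
  let ?P = "\<lambda>k. pf_list (pair_form a b n c k)"
  let ?t = "tail_sum b n"
  have split: "wedge (?t k) F xs = wedge (b k) F xs + wedge (?t (Suc k)) F xs" for F
    using step.hyps by (simp add: tail_sum_rec wedge_add_left)
  have "wedge (?t k) (?P k) xs = wedge (b k) (?P (k + d)) xs + wedge (?t (Suc k)) (?P (Suc k)) xs"
  proof (cases "c = 0")
    case True
    then show ?thesis
      using wedge_tail_sum_absorb[of k n b c a xs] step.hyps assms(1) split by simp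
  next
    case False
    then have "c = 1" "d = 0" using assms(1) by auto
    then show ?thesis
      using wedge_tail_sum_absorb[of k n b c a xs] step.hyps split by simp
  qed
  then show ?case
    using step.IH step.hyps by (simp add: sum.atLeast_Suc_lessThan)
qed

text \<open>Either no pair starts at \<open>k\<close>, or the first pair is \<open>(k, j)\<close> and all later pairs start at
  \<open>j + d\<close> or later.\<close>

lemma pf_pair_form_first_pair:
  assumes "c + d = 1" "k < n"
  shows "pf_list (pair_form a b n c k) xs = pf_list (pair_form a b n c (Suc k)) xs
    + (\<Sum>j\<in>{k + c..<n}. wedge (a k) (wedge (b j) (pf_list (pair_form a b n c (j + d)))) xs)"
proof -
  have "wedge (tail_sum b n (k + c)) (pf_list (pair_form a b n c (Suc k))) ys
      = wedge (tail_sum b n (k + c)) (pf_list (pair_form a b n c (k + c))) ys" for ys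
  proof (cases "c = 0")
    case True
    then show ?thesis
      using wedge_tail_sum_absorb[OF assms(2), of b c a ys] by simp
  next
    case False
    then have "c = 1" using assms(1) by auto
    then show ?thesis by simp
  qed
  also have "\<dots> ys = (\<Sum>j\<in>{k + c..<n}. wedge (b j) (pf_list (pair_form a b n c (j + d))) ys)" for ys
    by (rule wedge_tail_sum_pf) (use assms in auto)
  finally have "wedge (tail_sum b n (k + c)) (pf_list (pair_form a b n c (Suc k)))
      = (\<lambda>ys. \<Sum>j\<in>{k + c..<n}. wedge (b j) (pf_list (pair_form a b n c (j + d))) ys)" ..
  then show ?thesis
    by (simp only: pf_pair_form_rec[OF assms(2)] wedge_sum)
qed

text \<open>The length of \<open>xs\<close> selects the part of degree \<open>2 * h\<close> of the Pfaffian. The outer induction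
  is on the number of pairs, the inner one on the start of the first pair.\<close>

lemma pf_pair_form_eq_sum_chains:
  assumes "c + d = 1" "k \<le> n" "length xs = 2 * h"
  shows "pf_list (pair_form a b n c k) xs
    = (\<Sum>(is, js)\<in>index_chains c d n h k. foldr wedge (interleave a b is js) unit_form xs)"
  using assms(2,3)
proof (induction h arbitrary: k xs)
  case 0
  then show ?case by (simp add: index_chains_0 unit_form_def)
next
  case (Suc h)
  let ?P = "\<lambda>k. pf_list (pair_form a b n c k)"
  let ?W = "\<lambda>is js. foldr wedge (interleave a b is js) unit_form"
  have pairs: "wedge (a i) (wedge (b j) (?P (j + d))) xs
      = (\<Sum>(is, js)\<in>index_chains c d n h (j + d). ?W (i # is) (j # js) xs)" if "j < n" for i j
  proof -
    have "wedge (a i) (wedge (b j) (?P (j + d))) xs = wedge (a i) (wedge (b j)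
        (\<lambda>ys. \<Sum>s\<in>index_chains c d n h (j + d). ?W (fst s) (snd s) ys)) xs"
      by (intro wedge_cong refl) (use that Suc assms(1) in \<open>auto simp: case_prod_unfold\<close>)
    then show ?thesis
      by (simp add: ext[OF wedge_sum] case_prod_unfold)
  qed
  have "?P k xs = (\<Sum>i\<in>{k..<n}. \<Sum>j\<in>{i + c..<n}. wedge (a i) (wedge (b j) (?P (j + d))) xs)"
    using Suc.prems(1)
  proof (induction k rule: inc_induct)
    case base
    have "pair_form a b n c n = (\<lambda>x y. 0)"
      by (simp add: pair_form_def fun_eq_iff)
    then have "?P n xs = unit_form xs"
      by (simp only: pf_list_zero)
    then show ?case
      using Suc.prems(2) by (auto simp: unit_form_def)
  next
    case (step k)
    then show ?case
      using pf_pair_form_first_pair[OF assms(1) step.hyps(2), of a b xs]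
      by (simp add: sum.atLeast_Suc_lessThan)
  qed
  also have "\<dots> = (\<Sum>i\<in>{k..<n}. \<Sum>j\<in>{i + c..<n}.
      \<Sum>(is, js)\<in>index_chains c d n h (j + d). ?W (i # is) (j # js) xs)"
    by (intro sum.cong refl) (auto simp: pairs)
  finally show ?case
    by (simp only: sum_index_chains_Suc[where f = "\<lambda>is js. ?W is js xs"])
qed

section \<open>Pfaffians by matchings\<close>

text \<open>The matchings of an arbitrary finite set are needed because an expansion step leaves
  a set with a gap.\<close>

definition matchings :: "nat set \<Rightarrow> nat set set set" where
  "matchings S = {\<mu>. partition_on S \<mu> \<and> (\<forall>e\<in>\<mu>. card e = 2)}"

definition match_term :: "(nat \<Rightarrow> nat \<Rightarrow> 'a :: comm_ring_1) \<Rightarrow> nat set set \<Rightarrow> 'a" where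
  "match_term Y \<mu> = (- 1) ^ crossings \<mu> * (\<Prod>(i, j)\<in>{(i, j). i < j \<and> {i, j} \<in> \<mu>}. Y i j)"

lemma matchings_edge:
  assumes "\<mu> \<in> matchings S" "e \<in> \<mu>"
  obtains j l where "j < l" "e = {j, l}" "j \<in> S" "l \<in> S"
proof -
  have "card e = 2" "e \<subseteq> S"
    using assms by (auto simp: matchings_def partition_on_def)
  then obtain u v where "e = {u, v}" "u \<noteq> v" "u \<in> S" "v \<in> S"
    by (auto simp: card_2_iff)
  then show thesis
    using that[of u v] that[of v u] by (cases "u < v") (auto simp: insert_commute)
qed

text \<open>A matching of \<open>insert x S\<close> consists of the partner \<open>y\<close> of \<open>x\<close> and a matching of the rest.\<close>

lemma matchings_insert_min:
  assumes "x \<notin> S"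
  shows "bij_betw (\<lambda>(y, \<mu>). insert {x, y} \<mu>) (SIGMA y:S. matchings (S - {y})) (matchings (insert x S))"
proof (rule bij_betw_imageI)
  have no_x: "x \<notin> e" if "\<mu> \<in> matchings (S - {y})" "e \<in> \<mu>" for y \<mu> e
    using that assms by (auto simp: matchings_def partition_on_def)
  show "inj_on (\<lambda>(y, \<mu>). insert {x, y} \<mu>) (SIGMA y:S. matchings (S - {y}))"
  proof (clarsimp simp: inj_on_def)
    fix y \<mu> z \<nu>
    assume y: "y \<in> S" "\<mu> \<in> matchings (S - {y})" and z: "z \<in> S" "\<nu> \<in> matchings (S - {z})"
      and eq: "insert {x, y} \<mu> = insert {x, z} \<nu>"
    have "{x, y} \<in> insert {x, z} \<nu>"
      using eq by blast
    then have "{x, y} = {x, z}"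
      using no_x[OF z(2), of "{x, y}"] by blast
    moreover have "{x, y} \<notin> \<mu>" "{x, z} \<notin> \<nu>"
      using no_x[OF y(2), of "{x, y}"] no_x[OF z(2), of "{x, z}"] by blast+
    ultimately show "y = z \<and> \<mu> = \<nu>"
      using eq by (metis doubleton_eq_iff insert_ident)
  qed
  show "(\<lambda>(y, \<mu>). insert {x, y} \<mu>) ` (SIGMA y:S. matchings (S - {y})) = matchings (insert x S)"
  proof (intro subset_antisym subsetI)
    fix \<nu> assume "\<nu> \<in> (\<lambda>(y, \<mu>). insert {x, y} \<mu>) ` (SIGMA y:S. matchings (S - {y}))"
    then obtain y \<mu> where y: "y \<in> S" "\<mu> \<in> matchings (S - {y})" and \<nu>: "\<nu> = insert {x, y} \<mu>"
      by auto
    have "card {x, y} = 2" "disjnt {x, y} (\<Union> \<mu>)" "\<Union> \<mu> = S - {y}"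
      using y assms by (auto simp: matchings_def partition_on_def card_2_iff)
    then show "\<nu> \<in> matchings (insert x S)"
      using y assms unfolding \<nu> matchings_def
      by (auto simp: partition_on_def pairwise_insert disjnt_def)
  next
    fix \<nu> assume \<nu>: "\<nu> \<in> matchings (insert x S)"
    then obtain e where e: "e \<in> \<nu>" "x \<in> e"
      by (auto simp: matchings_def partition_on_def)
    then obtain y where y: "e = {x, y}" "y \<in> S"
      using matchings_edge[OF \<nu> e(1)] by (metis insertE insert_commute nat_neq_iff singletonD)
    have "\<Union> (\<nu> - {e}) = \<Union> \<nu> - e"
      using \<nu> e(1) by (auto simp: matchings_def partition_on_def disjoint_def)
    then have "\<nu> - {e} \<in> matchings (S - {y})"
      using \<nu> y assms by (auto simp: matchings_def partition_on_def pairwise_def)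
    then show "\<nu> \<in> (\<lambda>(y, \<mu>). insert {x, y} \<mu>) ` (SIGMA y:S. matchings (S - {y}))"
      using e y by (intro image_eqI[of _ _ "(y, \<nu> - {e})"]) auto
  qed
qed

text \<open>An edge with both ends on the same side of \<open>y\<close> contributes an even number of points below
  \<open>y\<close>, an edge that straddles \<open>y\<close> contributes one. So up to parity the points below \<open>y\<close> count the
  straddling edges, which are the edges that cross an edge from the minimum to \<open>y\<close>.\<close>

lemma minus_one_power_card_below:
  assumes "finite S" "\<mu> \<in> matchings S" "y \<notin> S"
  shows "(- 1 :: 'a :: comm_ring_1) ^ card {z\<in>S. z < y}
    = (- 1) ^ card {(j, l). j < y \<and> y < l \<and> {j, l} \<in> \<mu>}"
proof -
  let ?straddles = "\<lambda>e. \<exists>j l. e = {j, l} \<and> j < y \<and> y < l"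
  have edges: "\<Union> \<mu> = S" "disjoint \<mu>" "finite \<mu>"
    using assms by (auto simp: matchings_def partition_on_def intro: finite_elements)
  have "{z\<in>S. z < y} = (\<Union>e\<in>\<mu>. {z\<in>e. z < y})"
    using edges(1) by auto
  also have "card \<dots> = (\<Sum>e\<in>\<mu>. card {z\<in>e. z < y})"
    using edges assms(1)
    by (intro card_UN_disjoint) (auto simp: disjoint_def intro: finite_subset[of _ S])
  finally have "(- 1 :: 'a) ^ card {z\<in>S. z < y} = (\<Prod>e\<in>\<mu>. (- 1) ^ card {z\<in>e. z < y})"
    by (simp add: power_sum)
  also have "\<dots> = (\<Prod>e\<in>\<mu>. if ?straddles e then - 1 else 1)"
  proof (rule prod.cong)
    fix e assume "e \<in> \<mu>"
    then obtain j l where jl: "j < l" "e = {j, l}" "j \<in> S" "l \<in> S"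
      using matchings_edge[OF assms(2)] by blast
    then have "j \<noteq> y" "l \<noteq> y" using assms(3) by auto
    then consider "l < y" | "j < y" "y < l" | "y < j" using jl(1) by linarith
    then show "(- 1 :: 'a) ^ card {z\<in>e. z < y} = (if ?straddles e then - 1 else 1)"
    proof cases
      case 1
      then have "{z\<in>e. z < y} = {j, l}" using jl by auto
      then have "card {z\<in>e. z < y} = 2" using jl by simp
      moreover have "\<not> ?straddles e" using 1 jl by (auto simp: doubleton_eq_iff)
      ultimately show ?thesis by (simp only: if_not_P) simp
    next
      case 2
      then have "{z\<in>e. z < y} = {j}" using jl by auto
      moreover have "?straddles e" using 2 jl by blast
      ultimately show ?thesis by (simp only: if_P) simp
    next
      case 3
      then have "{z\<in>e. z < y} = {}" using jl by auto
      moreover have "\<not> ?straddles e" using 3 jl by (auto simp: doubleton_eq_iff)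
      ultimately show ?thesis by (simp only: if_not_P) simp
    qed
  qed simp
  also have "\<dots> = (- 1) ^ card {e\<in>\<mu>. ?straddles e}"
    using edges(3) by (simp add: prod.If_cases Int_def)
  also have "card {e\<in>\<mu>. ?straddles e} = card {(j, l). j < y \<and> y < l \<and> {j, l} \<in> \<mu>}"
  proof (rule bij_betw_same_card[symmetric, of "\<lambda>(j, l). {j, l}"], rule bij_betw_imageI)
    show "inj_on (\<lambda>(j, l). {j, l}) {(j, l). j < y \<and> y < l \<and> {j, l} \<in> \<mu>}"
      by (auto simp: inj_on_def doubleton_eq_iff)
  qed (auto simp: image_def)
  finally show ?thesis .
qed

lemma matchings_finite_crossings:
  assumes "finite S" "\<mu> \<in> matchings S"
  shows "finite {(i, j, k, l). i < j \<and> j < k \<and> k < l \<and> {i, k} \<in> \<mu> \<and> {j, l} \<in> \<mu>}"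
  by (rule finite_subset[of _ "S \<times> S \<times> S \<times> S"])
    (use assms in \<open>auto simp: matchings_def partition_on_def\<close>)

lemma matchings_finite_pairs:
  assumes "finite S" "\<mu> \<in> matchings S"
  shows "finite {(j, l). P j l \<and> {j, l} \<in> \<mu>}"
  by (rule finite_subset[of _ "S \<times> S"])
    (use assms in \<open>auto simp: matchings_def partition_on_def\<close>)

text \<open>Since \<open>x\<close> is minimal, the edge \<open>{x, y}\<close> can only be the left one of a crossing pair.\<close>

lemma crossings_insert_min:
  assumes "finite S" "\<And>z. z \<in> S \<Longrightarrow> x < z" "y \<in> S" "\<mu> \<in> matchings (S - {y})"
  shows "crossings (insert {x, y} \<mu>)
    = crossings \<mu> + card {(j, l). j < y \<and> y < l \<and> {j, l} \<in> \<mu>}"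
proof -
  let ?D = "{(j, l). j < y \<and> y < l \<and> {j, l} \<in> \<mu>}"
  let ?C = "\<lambda>\<mu>. {(i, j, k, l). i < j \<and> j < k \<and> k < l \<and> {i, k} \<in> \<mu> \<and> {j, l} \<in> \<mu>}"
  have above: "x < u \<and> x < v" if "{u, v} \<in> \<mu>" for u v
    using assms(2,4) that by (auto simp: matchings_def partition_on_def)
  have "x < y" using assms by auto
  have "?C (insert {x, y} \<mu>) = ?C \<mu> \<union> (\<lambda>(j, l). (x, j, y, l)) ` ?D"
    using \<open>x < y\<close> above by (fastforce simp: doubleton_eq_iff image_iff)
  moreover have "finite (?C \<mu>)"
    by (rule matchings_finite_crossings[OF _ assms(4)]) (use assms in simp)
  moreover have "finite ?D"
    using matchings_finite_pairs[OF _ assms(4), of "\<lambda>j l. j < y \<and> y < l"] assms(1) by simp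
  moreover have "?C \<mu> \<inter> (\<lambda>(j, l). (x, j, y, l)) ` ?D = {}"
    using above by fastforce
  moreover have "card ((\<lambda>(j, l). (x, j, y, l)) ` ?D) = card ?D"
    by (rule card_image) (auto simp: inj_on_def)
  ultimately show ?thesis
    by (simp add: crossings_def card_Un_disjoint)
qed

lemma match_term_insert_min:
  assumes "finite S" "\<And>z. z \<in> S \<Longrightarrow> x < z" "y \<in> S" "\<mu> \<in> matchings (S - {y})"
  shows "match_term Y (insert {x, y} \<mu>) = (- 1) ^ card {z\<in>S. z < y} * Y x y * match_term Y \<mu>"
proof -
  have "x < y" using assms by auto
  have x: "(x, y) \<notin> {(i, j). i < j \<and> {i, j} \<in> \<mu>}"
    using assms(4) by (auto simp: matchings_def partition_on_def)
  have "{(i, j). i < j \<and> {i, j} \<in> insert {x, y} \<mu>} = insert (x, y) {(i, j). i < j \<and> {i, j} \<in> \<mu>}"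
    using \<open>x < y\<close> by (auto simp: doubleton_eq_iff)
  then have "(\<Prod>(i, j)\<in>{(i, j). i < j \<and> {i, j} \<in> insert {x, y} \<mu>}. Y i j)
      = Y x y * (\<Prod>(i, j)\<in>{(i, j). i < j \<and> {i, j} \<in> \<mu>}. Y i j)"
    using x matchings_finite_pairs[OF _ assms(4), of "(<)"] assms(1) by simp
  moreover have "{z\<in>S. z < y} = {z\<in>S - {y}. z < y}"
    by auto
  ultimately show ?thesis
    using minus_one_power_card_below[OF _ assms(4), where 'a = 'a] assms(1)
    by (simp add: match_term_def crossings_insert_min[OF assms] power_add)
qed

text \<open>On a sorted list the position of an entry is the number of smaller entries. This form of
  the product refers to the set of entries only, as the matchings do.\<close>

lemma wedge_sorted:
  fixes ys :: "nat list"
  assumes "sorted_wrt (<) ys"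
  shows "wedge v F ys = (\<Sum>y\<in>set ys. (- 1) ^ card {z\<in>set ys. z < y} * v y * F (remove1 y ys))"
  using assms
proof (induction ys arbitrary: F)
  case (Cons y ys)
  have y: "y \<notin> set ys" "{z. (z = y \<or> z \<in> set ys) \<and> z < y} = {}" using Cons.prems by auto
  have below: "card {z. (z = y \<or> z \<in> set ys) \<and> z < u} = Suc (card {z\<in>set ys. z < u})"
    if "u \<in> set ys" for u
  proof -
    have "{z. (z = y \<or> z \<in> set ys) \<and> z < u} = insert y {z\<in>set ys. z < u}"
      using that Cons.prems by auto
    then show ?thesis using y by simp
  qed
  have "wedge v F (y # ys) = v y * F ys
      - (\<Sum>u\<in>set ys. (- 1) ^ card {z\<in>set ys. z < u} * v u * F (y # remove1 u ys))"
    using Cons by simp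
  also have "\<dots> = v y * F ys
      + (\<Sum>u\<in>set ys. (- 1) ^ card {z. (z = y \<or> z \<in> set ys) \<and> z < u} * v u * F (remove1 u (y # ys)))"
    unfolding diff_conv_add_uminus sum_negf[symmetric]
    by (intro arg_cong2[of _ _ _ _ "(+)"] sum.cong refl) (use y in \<open>auto simp: below\<close>)
  finally show ?case using y by (simp del: Collect_empty_eq)
qed simp

text \<open>Both sides satisfy the expansion along the smallest entry.\<close>

lemma sum_matchings_eq_pf_list:
  assumes "sorted_wrt (<) xs"
  shows "(\<Sum>\<mu>\<in>matchings (set xs). match_term Y \<mu>) = pf_list Y xs"
  using assms
proof (induction "length xs" arbitrary: xs rule: less_induct)
  case less
  show ?case
  proof (cases xs)
    case Nil
    have "matchings {} = {{}}"
      by (auto simp: matchings_def partition_on_def)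
    then show ?thesis using Nil by (simp add: match_term_def crossings_def case_prod_unfold)
  next
    case (Cons x ys)
    then have sorted: "sorted_wrt (<) ys" and x: "x \<notin> set ys" "\<And>z. z \<in> set ys \<Longrightarrow> x < z"
      using less.prems by auto
    have fin: "finite (matchings (set ys - {y}))" for y
      by (rule finite_subset[of _ "Pow (Pow (set ys))"]) (auto simp: matchings_def partition_on_def)
    have "(\<Sum>\<mu>\<in>matchings (set xs). match_term Y \<mu>)
        = (\<Sum>(y, \<mu>)\<in>(SIGMA y:set ys. matchings (set ys - {y})). match_term Y (insert {x, y} \<mu>))"
      using sum.reindex_bij_betw[OF matchings_insert_min[OF x(1)], of "match_term Y"]
      by (simp add: Cons case_prod_unfold)
    also have "\<dots> = (\<Sum>y\<in>set ys. \<Sum>\<mu>\<in>matchings (set ys - {y}). match_term Y (insert {x, y} \<mu>))"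
      by (rule sum.Sigma[symmetric]) (auto simp: fin)
    also have "\<dots> = (\<Sum>y\<in>set ys. (- 1) ^ card {z\<in>set ys. z < y} * Y x y
        * (\<Sum>\<mu>\<in>matchings (set ys - {y}). match_term Y \<mu>))"
      unfolding sum_distrib_left
      by (intro sum.cong refl) (simp add: match_term_insert_min x)
    also have "\<dots> = (\<Sum>y\<in>set ys. (- 1) ^ card {z\<in>set ys. z < y} * Y x y * pf_list Y (remove1 y ys))"
    proof (intro sum.cong refl arg_cong2[of _ _ _ _ "(*)"])
      fix y assume y: "y \<in> set ys"
      have "distinct ys" using sorted by (simp add: strict_sorted_iff)
      then have "sorted_wrt (<) (remove1 y ys)"
        using sorted by (simp add: distinct_remove1_removeAll removeAll_filter_not_eq sorted_wrt_filter)
      then show "(\<Sum>\<mu>\<in>matchings (set ys - {y}). match_term Y \<mu>) = pf_list Y (remove1 y ys)"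
        using less.hyps[of "remove1 y ys"] y \<open>distinct ys\<close>
        by (simp add: Cons length_remove1)
    qed
    also have "\<dots> = pf_list Y xs"
      by (simp add: Cons wedge_sorted[OF sorted])
    finally show ?thesis .
  qed
qed

lemma pfaffian_eq_pf_list: "pfaffian M = pf_list (\<lambda>i j. M $$ (i, j)) [0..<dim_row M]"
proof -
  have "sorted_wrt (<) [0..<dim_row M]" by simp
  from sum_matchings_eq_pf_list[OF this, of "\<lambda>i j. M $$ (i, j)"] show ?thesis
    by (simp add: pfaffian_def perfect_matchings_def matchings_def match_term_def)
qed

section \<open>The two summation formulas\<close>

lemma det_interleaved_cols:
  assumes A: "A \<in> carrier_mat m n" and B: "B \<in> carrier_mat m n"
    and len: "length is = length js" "2 * length is = m"
  shows "det (interleaved_cols A B is js)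
    = foldr wedge (interleave (\<lambda>i p. col A i $ p) (\<lambda>j p. col B j $ p) is js) unit_form [0..<m]"
proof -
  let ?cs = "interleave (\<lambda>i p. col A i $ p) (\<lambda>j p. col B j $ p) is js"
  have cs: "?cs = map (($)) (interleave (col A) (col B) is js)"
    using len(1) by (induction "is" js rule: list_induct2) (auto simp: fun_eq_iff)
  have length: "length (interleave (col A) (col B) is js) = m"
    using len(1) unfolding len(2)[symmetric] by (induction "is" js rule: list_induct2) auto
  have "interleaved_cols A B is js = mat m m (\<lambda>(i, j). (?cs ! j) ([0..<m] ! i))"
    unfolding cs using A length
    by (intro eq_matI)
      (auto simp: interleaved_cols_def interleave_def[symmetric] mat_of_cols_index)
  then show ?thesis
    using det_eq_wedge[of ?cs "[0..<m]"] length cs by simp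
qed

text \<open>The matrix \<open>M\<close> selects the admissible pairs. The matrix on the right is skew-symmetric: it
  is the difference of \<open>A * M * transpose_mat B\<close> and its transpose.\<close>

lemma sum_det_interleaved_cols:
  fixes A B :: "'a :: comm_ring_1 mat"
  assumes "c + d = 1" "even m" and A: "A \<in> carrier_mat m n" and B: "B \<in> carrier_mat m n"
    and M: "M \<in> carrier_mat n n" "\<And>i j. i < n \<Longrightarrow> j < n \<Longrightarrow> M $$ (i, j) = (if i + c \<le> j then 1 else 0)"
  shows "(\<Sum>(is, js)\<in>index_chains c d n (m div 2) 0. det (interleaved_cols A B is js))
    = pfaffian (A * M * transpose_mat B - B * transpose_mat M * transpose_mat A)"
proof -
  let ?a = "\<lambda>i p. col A i $ p" and ?b = "\<lambda>j p. col B j $ p"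
  let ?Y = "A * M * transpose_mat B - B * transpose_mat M * transpose_mat A"
  have dim: "dim_row ?Y = m" using B by simp
  have AMB: "(A * M * transpose_mat B) $$ (p, q) = (\<Sum>i<n. ?a i p * tail_sum ?b n (i + c) q)"
    if "p < m" "q < m" for p q
  proof -
    have "(M * transpose_mat B) $$ (i, q) = tail_sum ?b n (i + c) q" if "i < n" for i
    proof -
      have "(M * transpose_mat B) $$ (i, q) = (\<Sum>j\<in>{0..<n}. if i + c \<le> j then B $$ (q, j) else 0)"
        using \<open>q < m\<close> \<open>i < n\<close> M B by (auto simp: scalar_prod_def intro!: sum.cong)
      also have "\<dots> = (\<Sum>j\<in>{i + c..<n}. B $$ (q, j))"
        by (rule sum.mono_neutral_cong_right) auto
      finally show ?thesis
        using \<open>q < m\<close> B by (simp add: tail_sum_def)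
    qed
    moreover have "A * M * transpose_mat B = A * (M * transpose_mat B)"
      by (rule assoc_mult_mat) (use A B M in auto)
    ultimately show ?thesis
      using that A B M by (auto simp: scalar_prod_def atLeast0LessThan intro!: sum.cong)
  qed
  have BMA: "B * transpose_mat M * transpose_mat A = transpose_mat (A * M * transpose_mat B)"
  proof -
    have "transpose_mat (A * M * transpose_mat B) = B * transpose_mat (A * M)"
      by (subst transpose_mult[of _ m n]) (use A B M in auto)
    also have "transpose_mat (A * M) = transpose_mat M * transpose_mat A"
      by (rule transpose_mult) (use A M in auto)
    also have "B * (transpose_mat M * transpose_mat A) = B * transpose_mat M * transpose_mat A"
      by (rule assoc_mult_mat[symmetric]) (use A B M in auto)
    finally show ?thesis ..
  qed
  have entry: "?Y $$ (p, q) = pair_form ?a ?b n c 0 p q" if "p < m" "q < m" for p q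
  proof -
    have "?Y $$ (p, q) = (A * M * transpose_mat B) $$ (p, q) - (A * M * transpose_mat B) $$ (q, p)"
      unfolding BMA using that A B by simp
    then show ?thesis
      using that
      by (simp add: AMB pair_form_def sum_subtractf atLeast0LessThan mult.commute del: index_mult_mat)
  qed
  have "pfaffian ?Y = pf_list (pair_form ?a ?b n c 0) [0..<m]"
    unfolding pfaffian_eq_pf_list dim by (rule pf_list_cong) (simp add: entry)
  also have "\<dots> = (\<Sum>(is, js)\<in>index_chains c d n (m div 2) 0. foldr wedge (interleave ?a ?b is js) unit_form [0..<m])"
    by (rule pf_pair_form_eq_sum_chains) (use assms in auto)
  also have "\<dots> = (\<Sum>(is, js)\<in>index_chains c d n (m div 2) 0. det (interleaved_cols A B is js))"
    by (intro sum.cong refl)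
      (use assms(2) in \<open>auto simp: index_chains_def chain_iff det_interleaved_cols[OF A B]\<close>)
  finally show ?thesis by simp
qed

theorem theorem19:
  fixes m n :: nat and A B :: "'a :: comm_ring_1 mat"
  assumes "m > 0" and "n > 0" and "even m"
    and "A \<in> carrier_mat m n" and "B \<in> carrier_mat m n"
  shows "(\<Sum>(is, js)\<in>strict_weak_indices (m div 2) n. det (interleaved_cols A B is js)) =
           pfaffian (A * strict_upper_ones n * transpose_mat B
             - B * transpose_mat (strict_upper_ones n) * transpose_mat A)
       \<and> (\<Sum>(is, js)\<in>weak_strict_indices (m div 2) n. det (interleaved_cols A B is js)) =
           pfaffian (A * (strict_upper_ones n + 1\<^sub>m n) * transpose_mat B
             - B * (transpose_mat (strict_upper_ones n) + 1\<^sub>m n) * transpose_mat A)"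
proof
  let ?U = "strict_upper_ones n :: 'a mat"
  show "(\<Sum>(is, js)\<in>strict_weak_indices (m div 2) n. det (interleaved_cols A B is js)) =
      pfaffian (A * ?U * transpose_mat B - B * transpose_mat ?U * transpose_mat A)"
    unfolding strict_weak_indices_eq_index_chains
    by (rule sum_det_interleaved_cols) (use assms in \<open>auto simp: strict_upper_ones_def\<close>)
  have "transpose_mat ?U + 1\<^sub>m n = transpose_mat (?U + 1\<^sub>m n)"
    by (rule eq_matI) (auto simp: strict_upper_ones_def)
  then show "(\<Sum>(is, js)\<in>weak_strict_indices (m div 2) n. det (interleaved_cols A B is js)) =
      pfaffian (A * (?U + 1\<^sub>m n) * transpose_mat B
        - B * (transpose_mat ?U + 1\<^sub>m n) * transpose_mat A)"
    unfolding weak_strict_indices_eq_index_chains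
    by (simp only:) (rule sum_det_interleaved_cols, use assms in \<open>auto simp: strict_upper_ones_def\<close>)
qed

end
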